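(* Let $I_1,I_2\ge2$, let the row logit type be $L$ and the column logit type be one of $G,C,R$. Fix $K\ge1$, row scores $\mu_{k,1},\dots,\mu_{k,I_1}$ and column scores $\nu_{k,1},\dots,\nu_{k,I_2}$, $k=1,\dots,K$, prescribed values $\rho_1^*,\dots,\rho_K^*$, row margins $\pi_{i+}>0$ ($1\le i\le I_1$) and column totals $p(+,j,v)>0$ ($1\le j\le I_2-1$, $v\in\{0,1\}$). Consider the class of all strictly positive collections of $I_1\times 2$ tables $p(i,j,v)$, $i\in\{1,\dots,I_1\}$, $j\in\{1,\dots,I_2-1\}$, $v\in\{0,1\}$, satisfying $$\sum_{v}p(i,j,v)=\pi_{i+}\ \ (1\le i\le I_1,\ 1\le j\le I_2-1),\qquad \sum_{i=1}^{I_1}p(i,j,v)=p(+,j,v)\ \ (1\le j\le I_2-1,\ v=0,1),$$ $$\rho_k:=\sum_{j=1}^{I_2-1}\sum_{i=1}^{I_1}\sum_{v\in\{0,1\}}\mu_{k,i}\,\nu_{k,j+v}\,p(i,j,v)=\rho_k^*,\qquad k=1,\dots,K .$$ If a member of this class is closest to independence within the class, i.e. minimizes $$\sum_{j=1}^{I_2-1}\left[\sum_{i=1}^{I_1}\sum_{v\in\{0,1\}} r(i,j,v)\,\phi\!\left(\frac{p(i,j,v)}{r(i,j,v)}\right)\right],\qquad r(i,j,v)=\pi_{i+}\,p(+,j,v),$$ then it has the form $$p(i,j,v)=\pi_{i+}\,p(+,j,v)\,G\!\left(\alpha_{ij}+\beta_{jv}+\sum_{k=1}^K\psi_k\,\mu_{k,i}\,\nu_{k,j+v}\right)$$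 for all $i\in\{1,\dots,I_1\}$, $j\in\{1,\dots,I_2-1\}$, $v\in\{0,1\}$, for some real constants $\alpha_{ij},\beta_{jv},\psi_k$.
   Context: $X_1$ (rows, categories $1,\dots,I_1$) and $X_2$ (columns, categories $1,\dots,I_2$) are categorical variables. With row logit type $L$, $p(i,j,v)$ stands for $P(X_1=i,\ X_2\in E(j,v))$, where for a column cut point $j\in\{1,\dots,I_2-1\}$: if the column type is $G$, $E(j,0)=\{1,\dots,j\}$, $E(j,1)=\{j+1,\dots,I_2\}$; if $C$, $E(j,0)=\{j\}$, $E(j,1)=\{j+1,\dots,I_2\}$; if $R$, $E(j,0)=\{1,\dots,j\}$, $E(j,1)=\{j+1\}$. In the optimization problem the quantities $p(i,j,v)$ are the variables, viewed as a collection of $I_1\times2$ tables, one for each $j<I_2$; $\pi_{i+}$ denotes $P(X_1=i)$. $\phi$ is a real-valued convex function on $[0,\infty)$, differentiable on $(0,\infty)$, with $\phi(1)=\phi'(1)=0$; $F=\phi'$ is assumed strictly increasing on $(0,\infty)$, and $G=F^{-1}$ denotes its inverse. *)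

theory Defs
  imports "HOL-Analysis.Analysis"
begin

text \<open>
  A collection of \<open>I1\<close> by \<open>2\<close> tables, one for each column cut point \<open>1 \<le> j < I2\<close>, is a function
  \<open>p\<close> with entries \<open>p i j v\<close>, where \<open>i \<in> {1..I1}\<close>, \<open>j \<in> {1..<I2}\<close>, \<open>v \<in> {0, 1}\<close>; values outside
  these ranges are never used.  The entries are free variables subject only to the margin and
  score constraints below, so the column logit type (global, continuation or reverse
  continuation), which only says which event of the column variable \<open>p i j v\<close> refers to, does not
  enter: everything here applies verbatim to each of the three types.

  In all definitions \<open>\<pi> i\<close> is the \<open>i\<close>-th row margin and \<open>c j v\<close> is the column total \<open>p(+,j,v)\<close>.
\<close>

type_synonym tables = "nat \<Rightarrow> nat \<Rightarrow> nat \<Rightarrow> real"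

definition score_moment ::
  "nat \<Rightarrow> nat \<Rightarrow> (nat \<Rightarrow> real) \<Rightarrow> (nat \<Rightarrow> real) \<Rightarrow> tables \<Rightarrow> real" where
  "score_moment I1 I2 \<mu> \<nu> p =
     (\<Sum>j\<in>{1..<I2}. \<Sum>i\<in>{1..I1}. \<Sum>v\<in>{0, 1}. \<mu> i * \<nu> (j + v) * p i j v)"

definition table_class ::
  "nat \<Rightarrow> nat \<Rightarrow> nat \<Rightarrow> (nat \<Rightarrow> nat \<Rightarrow> real) \<Rightarrow> (nat \<Rightarrow> nat \<Rightarrow> real) \<Rightarrow> (nat \<Rightarrow> real) \<Rightarrow>
   (nat \<Rightarrow> real) \<Rightarrow> (nat \<Rightarrow> nat \<Rightarrow> real) \<Rightarrow> tables set" where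
  "table_class I1 I2 K \<mu> \<nu> \<rho> \<pi> c =
     {p. (\<forall>i\<in>{1..I1}. \<forall>j\<in>{1..<I2}. \<forall>v\<in>{0, 1}. 0 < p i j v) \<and>
         (\<forall>i\<in>{1..I1}. \<forall>j\<in>{1..<I2}. (\<Sum>v\<in>{0, 1}. p i j v) = \<pi> i) \<and>
         (\<forall>j\<in>{1..<I2}. \<forall>v\<in>{0, 1}. (\<Sum>i\<in>{1..I1}. p i j v) = c j v) \<and>
         (\<forall>k\<in>{1..K}. score_moment I1 I2 (\<mu> k) (\<nu> k) p = \<rho> k)}"

definition divergence_from_independence ::
  "(real \<Rightarrow> real) \<Rightarrow> nat \<Rightarrow> nat \<Rightarrow> (nat \<Rightarrow> real) \<Rightarrow> (nat \<Rightarrow> nat \<Rightarrow> real) \<Rightarrow> tables \<Rightarrow> real" where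
  "divergence_from_independence \<phi> I1 I2 \<pi> c p =
     (\<Sum>j\<in>{1..<I2}. \<Sum>i\<in>{1..I1}. \<Sum>v\<in>{0, 1}.
        let r = \<pi> i * c j v in r * \<phi> (p i j v / r))"

end

theory Submission
  imports Defs
begin

text \<open>
  The feasible set is cut out of the open positive orthant by linear equations, so along every
  direction annihilated by the linear constraints the objective restricted to a line through the
  minimizer has an interior local minimum.  Hence the gradient, whose entries are
  \<open>F (p i j v / r i j v)\<close>, annihilates the common kernel of the constraints and is a linear
  combination of them; applying \<open>G\<close> gives the claimed form.
\<close>

text \<open>The functionals \<open>f m\<close> are added one at a time. If the new one vanishes on
  the common kernel of the earlier ones, it may take weight 0; otherwise subtracting a suitable
  multiple of it from \<open>g\<close> leaves a functional that vanishes on that kernel. This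
  supplies the Lagrange multipliers, and redundant constraints do no harm.\<close>

lemma linear_combination_if_kernel_subset:
  fixes f :: "'m \<Rightarrow> 'a \<Rightarrow> real" and g :: "'a \<Rightarrow> real"
  assumes "finite T" "finite M"
    and "\<And>d. (\<And>m. m \<in> M \<Longrightarrow> (\<Sum>t\<in>T. f m t * d t) = 0) \<Longrightarrow> (\<Sum>t\<in>T. g t * d t) = 0"
  shows "\<exists>w. \<forall>t\<in>T. g t = (\<Sum>m\<in>M. w m * f m t)"
  using assms(2,3)
proof (induction M arbitrary: g rule: finite_induct)
  case empty
  \<comment> \<open>With no constraints every vector is a test direction; the indicator of
    \<open>t\<close> reads off the coefficient \<open>g t\<close>.\<close>
  have "g t = 0" if "t \<in> T" for t
    using empty[of "\<lambda>s. of_bool (s = t)"] that assms(1) by simp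
  then show ?case by simp
next
  case (insert a M)
  show ?case
  \<comment> \<open>Does \<open>f a\<close> already vanish on the common kernel of the functionals
    in \<open>M\<close>?\<close>
  proof (cases "\<forall>d. (\<forall>m\<in>M. (\<Sum>t\<in>T. f m t * d t) = 0) \<longrightarrow> (\<Sum>t\<in>T. f a t * d t) = 0")
    case True
    then have "\<exists>w. \<forall>t\<in>T. g t = (\<Sum>m\<in>M. w m * f m t)"
      by (intro insert.IH insert.prems) auto
    then obtain w where w: "\<forall>t\<in>T. g t = (\<Sum>m\<in>M. w m * f m t)" ..
    have "(\<Sum>m\<in>M. (w(a := 0)) m * f m t) = (\<Sum>m\<in>M. w m * f m t)" for t
      using insert.hyps by (intro sum.cong) auto
    then show ?thesis
      using w insert.hyps by (intro exI[of _ "w(a := 0)"]) (simp del: fun_upd_apply, simp)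
  next
    case False
    then obtain e where e: "\<And>m. m \<in> M \<Longrightarrow> (\<Sum>t\<in>T. f m t * e t) = 0"
      and ea: "(\<Sum>t\<in>T. f a t * e t) \<noteq> 0" by blast
    \<comment> \<open>\<open>A\<close> and \<open>B\<close> are the values of \<open>f a\<close> and
      \<open>g\<close> at \<open>e\<close>. As \<open>e\<close> is killed by all of
      \<open>M\<close>, the weight of \<open>f a\<close> is forced to be
      \<open>B / A\<close>.\<close>
    define A where "A = (\<Sum>t\<in>T. f a t * e t)"
    define B where "B = (\<Sum>t\<in>T. g t * e t)"
    have "\<exists>w. \<forall>t\<in>T. g t - B / A * f a t = (\<Sum>m\<in>M. w m * f m t)"
    proof (rule insert.IH)
      fix d assume d: "\<And>m. m \<in> M \<Longrightarrow> (\<Sum>t\<in>T. f m t * d t) = 0"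
      \<comment> \<open>Moving \<open>d\<close> along \<open>e\<close> by \<open>- C / A\<close>
        stays in the kernel of \<open>M\<close> and also kills \<open>f a\<close>, so the hypothesis
        on \<open>g\<close> applies to the corrected direction.\<close>
      define C where "C = (\<Sum>t\<in>T. f a t * d t)"
      have split: "(\<Sum>t\<in>T. h t * (d t - C / A * e t))
          = (\<Sum>t\<in>T. h t * d t) - C / A * (\<Sum>t\<in>T. h t * e t)" for h :: "'a \<Rightarrow> real"
        by (simp add: sum_subtractf sum_distrib_left algebra_simps)
      have "(\<Sum>t\<in>T. f m t * (d t - C / A * e t)) = 0" if "m \<in> insert a M" for m
        unfolding split using that d e ea by (auto simp: A_def C_def)
      then have "(\<Sum>t\<in>T. g t * (d t - C / A * e t)) = 0"
        by (rule insert.prems)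
      then have "(\<Sum>t\<in>T. g t * d t) = C / A * B"
        unfolding split by (simp add: B_def)
      moreover have "(\<Sum>t\<in>T. (g t - B / A * f a t) * d t) = (\<Sum>t\<in>T. g t * d t) - B / A * C"
        by (simp add: C_def sum_subtractf sum_distrib_left algebra_simps)
      ultimately show "(\<Sum>t\<in>T. (g t - B / A * f a t) * d t) = 0"
        by simp
    qed
    then obtain w where w: "\<forall>t\<in>T. g t - B / A * f a t = (\<Sum>m\<in>M. w m * f m t)" ..
    have eq: "(\<Sum>m\<in>M. (w(a := B / A)) m * f m t) = (\<Sum>m\<in>M. w m * f m t)" for t
      using insert.hyps by (intro sum.cong) auto
    have "g t = (\<Sum>m\<in>insert a M. (w(a := B / A)) m * f m t)" if "t \<in> T" for t
      unfolding sum.insert[OF insert.hyps] eq using w that by (simp add: algebra_simps)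
    then show ?thesis by blast
  qed
qed

text \<open>Since \<open>d\<close> solves the homogeneous constraints, \<open>p + s * d\<close>
  keeps the margins and scores of \<open>p\<close>, and it stays positive for small \<open>s\<close>
  because there are finitely many cells. So \<open>s = 0\<close> is a local minimum of the
  divergence along this line, and its derivative there vanishes.\<close>

lemma gradient_orthogonal_to_feasible_direction:
  assumes diff: "\<And>x. 0 < x \<Longrightarrow> \<phi> differentiable (at x)"
    and pos_row: "\<And>i. i \<in> {1..I1} \<Longrightarrow> 0 < \<pi> i"
    and pos_col: "\<And>j v. j \<in> {1..<I2} \<Longrightarrow> v \<in> {0, 1} \<Longrightarrow> 0 < c j v"
    and min: "is_arg_min (divergence_from_independence \<phi> I1 I2 \<pi> c)
           (\<lambda>q. q \<in> table_class I1 I2 K \<mu> \<nu> \<rho> \<pi> c) p"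
    and rows: "\<And>i j. i \<in> {1..I1} \<Longrightarrow> j \<in> {1..<I2} \<Longrightarrow> (\<Sum>v\<in>{0, 1}. d i j v) = 0"
    and cols: "\<And>j v. j \<in> {1..<I2} \<Longrightarrow> v \<in> {0, 1} \<Longrightarrow> (\<Sum>i\<in>{1..I1}. d i j v) = 0"
    and scores: "\<And>k. k \<in> {1..K} \<Longrightarrow> score_moment I1 I2 (\<mu> k) (\<nu> k) d = 0"
  shows "(\<Sum>j\<in>{1..<I2}. \<Sum>i\<in>{1..I1}. \<Sum>v\<in>{0, 1}.
            deriv \<phi> (p i j v / (\<pi> i * c j v)) * d i j v) = 0"
proof -
  define q where "q s i j v = p i j v + s * d i j v" for s i j v
  define h where "h s = divergence_from_independence \<phi> I1 I2 \<pi> c (q s)" for s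
  have p: "p \<in> table_class I1 I2 K \<mu> \<nu> \<rho> \<pi> c"
    and p_le: "\<And>q. q \<in> table_class I1 I2 K \<mu> \<nu> \<rho> \<pi> c \<Longrightarrow>
      divergence_from_independence \<phi> I1 I2 \<pi> c p \<le> divergence_from_independence \<phi> I1 I2 \<pi> c q"
    using min by (auto simp: is_arg_min_def not_less)
  have p_pos: "0 < p i j v" if "i \<in> {1..I1}" "j \<in> {1..<I2}" "v \<in> {0, 1}" for i j v
    using p that unfolding table_class_def by blast
  \<comment> \<open>The filter \<open>at 0\<close> is punctured, so the radius obtained from it
    speaks only of \<open>s \<noteq> 0\<close>; the point \<open>s = 0\<close> is treated at the
    end.\<close>
  have "\<forall>\<^sub>F s in at 0. 0 < q s i j v"
    if "i \<in> {1..I1}" "j \<in> {1..<I2}" "v \<in> {0, 1}" for i j v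
  proof -
    have "((\<lambda>s. q s i j v) \<longlongrightarrow> p i j v + 0 * d i j v) (at 0)"
      unfolding q_def by (intro tendsto_intros)
    then show ?thesis
      using p_pos[OF that] by (auto dest!: order_tendstoD(1)[where a = 0])
  qed
  then have "\<forall>\<^sub>F s in at 0. \<forall>i\<in>{1..I1}. \<forall>j\<in>{1..<I2}. \<forall>v\<in>{0, 1}. 0 < q s i j v"
    by (intro eventually_ball_finite ballI) auto
  then obtain \<delta> where \<delta>: "0 < \<delta>"
    and q_pos0: "\<And>s. s \<noteq> 0 \<Longrightarrow> \<bar>s\<bar> < \<delta> \<Longrightarrow>
      \<forall>i\<in>{1..I1}. \<forall>j\<in>{1..<I2}. \<forall>v\<in>{0, 1}. 0 < q s i j v"
    unfolding eventually_at by (auto simp: dist_real_def)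
  have q_class: "q s \<in> table_class I1 I2 K \<mu> \<nu> \<rho> \<pi> c" if "\<bar>s\<bar> < \<delta>" "s \<noteq> 0" for s
  proof -
    have "(\<Sum>v\<in>{0, 1}. q s i j v) = \<pi> i" if "i \<in> {1..I1}" "j \<in> {1..<I2}" for i j
    proof -
      have "(\<Sum>v\<in>{0, 1}. q s i j v) = (\<Sum>v\<in>{0, 1}. p i j v) + s * (\<Sum>v\<in>{0, 1}. d i j v)"
        by (simp add: q_def algebra_simps)
      moreover have "(\<Sum>v\<in>{0, 1}. p i j v) = \<pi> i"
        using p that unfolding table_class_def by blast
      ultimately show ?thesis
        unfolding rows[OF that] by simp
    qed
    moreover have "(\<Sum>i\<in>{1..I1}. q s i j v) = c j v" if "j \<in> {1..<I2}" "v \<in> {0, 1}" for j v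
    proof -
      have "(\<Sum>i\<in>{1..I1}. q s i j v) = (\<Sum>i\<in>{1..I1}. p i j v) + s * (\<Sum>i\<in>{1..I1}. d i j v)"
        by (simp add: q_def sum.distrib sum_distrib_left)
      moreover have "(\<Sum>i\<in>{1..I1}. p i j v) = c j v"
        using p that unfolding table_class_def by blast
      ultimately show ?thesis
        unfolding cols[OF that] by simp
    qed
    moreover have "score_moment I1 I2 (\<mu> k) (\<nu> k) (q s) = \<rho> k" if "k \<in> {1..K}" for k
    proof -
      have "score_moment I1 I2 (\<mu> k) (\<nu> k) (q s)
          = score_moment I1 I2 (\<mu> k) (\<nu> k) p + s * score_moment I1 I2 (\<mu> k) (\<nu> k) d"
        unfolding score_moment_def q_def sum_distrib_left sum.distrib[symmetric]
        by (intro sum.cong refl) (simp add: algebra_simps)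
      moreover have "score_moment I1 I2 (\<mu> k) (\<nu> k) p = \<rho> k"
        using p that unfolding table_class_def by blast
      ultimately show ?thesis
        unfolding scores[OF that] by simp
    qed
    ultimately show ?thesis
      using q_pos0[OF that(2,1)] unfolding table_class_def by blast
  qed
  have "(h has_real_derivative (\<Sum>j\<in>{1..<I2}. \<Sum>i\<in>{1..I1}. \<Sum>v\<in>{0, 1}.
            deriv \<phi> (p i j v / (\<pi> i * c j v)) * d i j v)) (at 0)"
    unfolding h_def divergence_from_independence_def Let_def
  proof (intro DERIV_sum)
    fix i j v :: nat assume ijv: "j \<in> {1..<I2}" "i \<in> {1..I1}" "v \<in> {0, 1}"
    define r where "r = \<pi> i * c j v"
    have r: "0 < r" using pos_row pos_col ijv by (simp add: r_def)
    have "(\<phi> has_real_derivative deriv \<phi> (p i j v / r)) (at (p i j v / r))"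
      using diff[of "p i j v / r"] p_pos[of i j v] ijv r
      by (auto simp: DERIV_deriv_iff_real_differentiable)
    then have "(\<phi> has_real_derivative deriv \<phi> (p i j v / r)) (at (q 0 i j v / r))"
      by (simp add: q_def)
    moreover have "((\<lambda>s. q s i j v / r) has_real_derivative d i j v / r) (at 0)"
      unfolding q_def using r by (auto intro!: derivative_eq_intros)
    ultimately have "((\<lambda>s. \<phi> (q s i j v / r)) has_real_derivative
        deriv \<phi> (p i j v / r) * (d i j v / r)) (at 0)"
      by (rule DERIV_chain2)
    \<comment> \<open>The inner derivative contributes \<open>1 / r\<close>, which the weight
      \<open>r\<close> in the divergence cancels; hence the gradient entry is just
      \<open>deriv \<phi>\<close> at the ratio.\<close>
    moreover have "r * (deriv \<phi> (p i j v / r) * (d i j v / r)) = deriv \<phi> (p i j v / r) * d i j v"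
      using r by simp
    ultimately have "((\<lambda>s. r * \<phi> (q s i j v / r)) has_real_derivative
        deriv \<phi> (p i j v / r) * d i j v) (at 0)"
      using DERIV_cmult[of _ _ 0 UNIV r] by metis
    then
    show "((\<lambda>s. \<pi> i * c j v * \<phi> (q s i j v / (\<pi> i * c j v))) has_real_derivative
        deriv \<phi> (p i j v / (\<pi> i * c j v)) * d i j v) (at 0)"
      unfolding r_def .
  qed
  then show ?thesis
  proof (rule DERIV_local_min[OF _ \<delta>], intro allI impI)
    fix s :: real assume "\<bar>0 - s\<bar> < \<delta>"
    moreover have "q 0 = p" by (simp add: q_def fun_eq_iff)
    ultimately show "h 0 \<le> h s"
      using p_le[OF q_class[of s]] by (cases "s = 0") (auto simp: h_def)
  qed
qed

theorem corollary1:
  fixes \<phi> F G :: "real \<Rightarrow> real"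
    and I1 I2 K :: nat
    and \<mu> \<nu> :: "nat \<Rightarrow> nat \<Rightarrow> real"
    and \<rho> \<pi> :: "nat \<Rightarrow> real"
    and c :: "nat \<Rightarrow> nat \<Rightarrow> real"
    and p :: tables
  assumes "convex_on {0..} \<phi>"
    and "\<And>x. 0 < x \<Longrightarrow> \<phi> differentiable (at x)"
    and "F = deriv \<phi>"
    and "\<phi> 1 = 0" and "F 1 = 0"
    and "strict_mono_on {0<..} F"
    and "G = the_inv_into {0<..} F"
    and "2 \<le> I1" and "2 \<le> I2" and "1 \<le> K"
    and "\<And>i. i \<in> {1..I1} \<Longrightarrow> 0 < \<pi> i"
    and "\<And>j v. j \<in> {1..<I2} \<Longrightarrow> v \<in> {0, 1} \<Longrightarrow> 0 < c j v"
    and "is_arg_min (divergence_from_independence \<phi> I1 I2 \<pi> c)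
           (\<lambda>q. q \<in> table_class I1 I2 K \<mu> \<nu> \<rho> \<pi> c) p"
  shows "\<exists>(\<alpha> :: nat \<Rightarrow> nat \<Rightarrow> real) (\<beta> :: nat \<Rightarrow> nat \<Rightarrow> real) (\<psi> :: nat \<Rightarrow> real).
           \<forall>i\<in>{1..I1}. \<forall>j\<in>{1..<I2}. \<forall>v\<in>{0, 1}.
             \<alpha> i j + \<beta> j v + (\<Sum>k\<in>{1..K}. \<psi> k * \<mu> k i * \<nu> k (j + v)) \<in> F ` {0<..} \<and>
             p i j v = \<pi> i * c j v *
               G (\<alpha> i j + \<beta> j v + (\<Sum>k\<in>{1..K}. \<psi> k * \<mu> k i * \<nu> k (j + v)))"
proof -
  define T where "T = {1..I1} \<times> {1..<I2} \<times> {0, 1 :: nat}"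
  \<comment> \<open>The gradient of the divergence at \<open>p\<close>, indexed by cells.\<close>
  define g where "g = (\<lambda>(i, j, v). F (p i j v / (\<pi> i * c j v)))"
  define M :: "(nat \<times> nat + nat \<times> nat + nat) set"
    \<comment> \<open>One index per linear constraint: row sums \<open>(i, j)\<close>, column totals
      \<open>(j, v)\<close>, then scores \<open>k\<close>.\<close>
    where "M = ({1..I1} \<times> {1..<I2}) <+> (({1..<I2} \<times> {0, 1}) <+> {1..K})"
  \<comment> \<open>The coefficient of a cell in each constraint; for the two kinds of margins it is
    the indicator of the cells being summed.\<close>
  define f :: "nat \<times> nat + nat \<times> nat + nat \<Rightarrow> nat \<times> nat \<times> nat \<Rightarrow> real"
    where "f m = (\<lambda>(i, j, v). case m of
        Inl x \<Rightarrow> of_bool (x = (i, j))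
      | Inr (Inl y) \<Rightarrow> of_bool (y = (j, v))
      | Inr (Inr k) \<Rightarrow> \<mu> k i * \<nu> k (j + v))" for m
  have sum_T: "(\<Sum>t\<in>T. e t) = (\<Sum>j\<in>{1..<I2}. \<Sum>i\<in>{1..I1}. \<Sum>v\<in>{0, 1}. e (i, j, v))"
    for e :: "nat \<times> nat \<times> nat \<Rightarrow> real"
    unfolding T_def sum.cartesian_product' by (rule sum.swap)
  have "\<exists>w. \<forall>t\<in>T. g t = (\<Sum>m\<in>M. w m * f m t)"
  proof (rule linear_combination_if_kernel_subset)
    fix d :: "nat \<times> nat \<times> nat \<Rightarrow> real"
    assume ker: "\<And>m. m \<in> M \<Longrightarrow> (\<Sum>t\<in>T. f m t * d t) = 0"
    have "(\<Sum>j\<in>{1..<I2}. \<Sum>i\<in>{1..I1}. \<Sum>v\<in>{0, 1}.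
            deriv \<phi> (p i j v / (\<pi> i * c j v)) * d (i, j, v)) = 0"
    proof (rule gradient_orthogonal_to_feasible_direction[OF assms(2,11,12,13)])
      fix i j :: nat assume ij: "i \<in> {1..I1}" "j \<in> {1..<I2}"
      \<comment> \<open>The indicator is written as nested conditionals on the summation indices, so
        that each one-point sum collapses.\<close>
      have "(\<Sum>t\<in>T. f (Inl (i, j)) t * d t)
          = (\<Sum>j'\<in>{1..<I2}. \<Sum>i'\<in>{1..I1}. if i' = i then
              (if j' = j then (\<Sum>v\<in>{0, 1}. d (i', j', v)) else 0) else 0)"
        unfolding sum_T by (intro sum.cong refl) (auto simp: f_def)
      then show "(\<Sum>v\<in>{0, 1}. d (i, j, v)) = 0"
        using ker[of "Inl (i, j)"] ij by (simp add: M_def InlI InrI)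
    next
      fix j v :: nat assume jv: "j \<in> {1..<I2}" "v \<in> {0, 1}"
      have "(\<Sum>t\<in>T. f (Inr (Inl (j, v))) t * d t)
          = (\<Sum>j'\<in>{1..<I2}. if j' = j then (\<Sum>i\<in>{1..I1}. d (i, j', v)) else 0)"
        unfolding sum_T using jv by (intro sum.cong refl) (auto simp: f_def)
      then show "(\<Sum>i\<in>{1..I1}. d (i, j, v)) = 0"
        using ker[of "Inr (Inl (j, v))"] jv by (simp add: M_def InlI InrI)
    next
      fix k assume k: "k \<in> {1..K}"
      have "(\<Sum>t\<in>T. f (Inr (Inr k)) t * d t)
          = score_moment I1 I2 (\<mu> k) (\<nu> k) (\<lambda>i j v. d (i, j, v))"
        unfolding sum_T score_moment_def by (simp add: f_def)
      then show "score_moment I1 I2 (\<mu> k) (\<nu> k) (\<lambda>i j v. d (i, j, v)) = 0"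
        using ker[of "Inr (Inr k)"] k by (simp add: M_def InlI InrI)
    qed
    then show "(\<Sum>t\<in>T. g t * d t) = 0"
      unfolding sum_T g_def assms(3) by simp
  qed (simp_all add: T_def M_def)
  then obtain w where w: "\<forall>t\<in>T. g t = (\<Sum>m\<in>M. w m * f m t)" ..
  \<comment> \<open>The three families of constants are the multipliers of the three kinds of
    constraints.\<close>
  define \<alpha> where "\<alpha> i j = w (Inl (i, j))" for i j
  define \<beta> where "\<beta> j v = w (Inr (Inl (j, v)))" for j v
  define \<psi> where "\<psi> k = w (Inr (Inr k))" for k
  have F_eq: "F (p i j v / (\<pi> i * c j v))
      = \<alpha> i j + \<beta> j v + (\<Sum>k\<in>{1..K}. \<psi> k * \<mu> k i * \<nu> k (j + v))"
    if ijv: "i \<in> {1..I1}" "j \<in> {1..<I2}" "v \<in> {0, 1}" for i j v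
  proof -
    \<comment> \<open>At a fixed cell only one row constraint and, for each column family, only one
      column constraint has a nonzero coefficient.\<close>
    have "(\<Sum>x\<in>{1..I1} \<times> {1..<I2}. w (Inl x) * f (Inl x) (i, j, v)) = \<alpha> i j"
      using ijv by (simp add: f_def \<alpha>_def)
    moreover have "(\<Sum>y\<in>{1..<I2} \<times> {0, 1}. w (Inr (Inl y)) * f (Inr (Inl y)) (i, j, v)) = \<beta> j v"
      using ijv by (simp add: f_def \<beta>_def)
    moreover have "g (i, j, v) = (\<Sum>m\<in>M. w m * f m (i, j, v))"
      using ijv by (intro bspec[OF w]) (simp add: T_def)
    ultimately show ?thesis
      by (simp add: M_def sum.Plus g_def \<psi>_def f_def mult.assoc)
  qed
  have "\<alpha> i j + \<beta> j v + (\<Sum>k\<in>{1..K}. \<psi> k * \<mu> k i * \<nu> k (j + v)) \<in> F ` {0<..} \<and>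
        p i j v = \<pi> i * c j v *
          G (\<alpha> i j + \<beta> j v + (\<Sum>k\<in>{1..K}. \<psi> k * \<mu> k i * \<nu> k (j + v)))"
    if ijv: "i \<in> {1..I1}" "j \<in> {1..<I2}" "v \<in> {0, 1}" for i j v
  proof -
    have "p \<in> table_class I1 I2 K \<mu> \<nu> \<rho> \<pi> c"
      using assms(13) by (simp add: is_arg_min_def)
    then have "0 < p i j v"
      using ijv unfolding table_class_def by blast
    moreover have r: "0 < \<pi> i * c j v"
      using assms(11,12) ijv by simp
    ultimately have x: "p i j v / (\<pi> i * c j v) \<in> {0<..}"
      by simp
    \<comment> \<open>Strict monotonicity makes \<open>F\<close> injective on the positive reals, so
      \<open>G\<close> undoes it there. The positive ratio also witnesses that the argument of
      \<open>G\<close> lies in the image of \<open>F\<close>, where \<open>the_inv_into\<close> is a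
      genuine inverse.\<close>
    have "G (F (p i j v / (\<pi> i * c j v))) = p i j v / (\<pi> i * c j v)"
      unfolding assms(7)
      by (rule the_inv_into_f_f[OF strict_mono_on_imp_inj_on[OF assms(6)] x])
    then show ?thesis
      unfolding F_eq[OF ijv, symmetric] using x r by auto
  qed
  then show ?thesis by blast
qed

end
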